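(* For $(x,y)\in\mathbb{N}\times\mathbb{N}$, there exists $n\ge 0$ with $(x,y)=(s(n),t(n))$ if and only if $x\ge y$, $(x,y)\ne(0,0)$, and $x\equiv y \pmod 2$. Furthermore, for each such pair $(x,y)$ there are at most two $n\ge 0$ with $(s(n),t(n))=(x,y)$.
   Context: Let $(a(n))_{n\ge 0}$ be the Rudin-Shapiro sequence, defined by $a(0)=1$, $a(2n)=a(n)$, $a(2n+1)=(-1)^n a(n)$ for $n\ge 0$. Let $s(n)=\sum_{0\le i\le n} a(i)$ and $t(n)=\sum_{0\le i\le n}(-1)^i a(i)$. Here $\mathbb{N}=\{0,1,2,\dots\}$. *)

theory Defs
  imports Main
begin

fun rudin_shapiro :: "nat \<Rightarrow> int" where
  "rudin_shapiro n =
     (if n = 0 then 1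
      else if even n then rudin_shapiro (n div 2)
      else (- 1) ^ (n div 2) * rudin_shapiro (n div 2))"

declare rudin_shapiro.simps [simp del]

lemma rudin_shapiro_0: "rudin_shapiro 0 = 1"
  by (simp add: rudin_shapiro.simps)

lemma rudin_shapiro_even: "rudin_shapiro (2 * n) = rudin_shapiro n"
  by (cases "n = 0") (simp_all add: rudin_shapiro.simps [of "2 * n"] rudin_shapiro_0)

lemma rudin_shapiro_odd: "rudin_shapiro (2 * n + 1) = (- 1) ^ n * rudin_shapiro n"
  by (simp add: rudin_shapiro.simps [of "Suc (2 * n)"])

definition rs_sum :: "nat \<Rightarrow> int" where
  "rs_sum n = (\<Sum>i\<le>n. rudin_shapiro i)"

definition rs_alt_sum :: "nat \<Rightarrow> int" where
  "rs_alt_sum n = (\<Sum>i\<le>n. (- 1) ^ i * rudin_shapiro i)"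

end

theory Submission
  imports Defs
begin

text \<open>
  Consider the lattice path $n \mapsto (s(n), t(n))$ and its vertical step
  $b(n) = (-1)^n a(n)$ into position $n$.  The parity of $s(n)$ determines that of $n$, so the
  triple $(s(n), t(n), b(n))$ determines the last edge of the path.  The triples at $2n$ and
  $2n+1$ are explicit functions of the triple at $n$, and these functions can be inverted.
  Descending along the inverses shows that every edge is used at most once, and that the edges
  that are used are exactly those into points $(x, y)$ with $0 \le y \le x$, $x > 0$ and
  $x \equiv y$ modulo 2 with $y > 0$ for an upward and $y < x$ for a downward step.  A point thus has
  at most two visits, one for each value of $b$, and at least one if it lies in the cone.
\<close>

definition rs_step :: "nat \<Rightarrow> int" where
  "rs_step n = (- 1) ^ n * rudin_shapiro n"

lemma rudin_shapiro_cases: "rudin_shapiro n = 1 \<or> rudin_shapiro n = - 1"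
proof (induction n rule: less_induct)
  case (less n)
  show ?case
  proof (cases "n = 0")
    case False
    then have "rudin_shapiro (n div 2) = 1 \<or> rudin_shapiro (n div 2) = - 1"
      by (intro less) auto
    then show ?thesis
      using False by (subst (1 2) rudin_shapiro.simps) (auto simp: minus_one_power_iff)
  qed (simp add: rudin_shapiro_0)
qed

lemma rs_step_cases: "rs_step n = 1 \<or> rs_step n = - 1"
  using rudin_shapiro_cases [of n] by (auto simp: rs_step_def minus_one_power_iff)

lemma rs_0 [simp]: "rs_sum 0 = 1" "rs_alt_sum 0 = 1" "rs_step 0 = 1"
  by (simp_all add: rs_sum_def rs_alt_sum_def rs_step_def rudin_shapiro_0)

lemma rs_sum_Suc: "rs_sum (Suc n) = rs_sum n + rudin_shapiro (Suc n)"
  by (simp add: rs_sum_def)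

lemma rs_alt_sum_Suc: "rs_alt_sum (Suc n) = rs_alt_sum n + rs_step (Suc n)"
  by (simp add: rs_alt_sum_def rs_step_def)

lemma rs_step_even: "rs_step (2 * n) = (- 1) ^ n * rs_step n"
  by (simp add: rs_step_def rudin_shapiro_even minus_one_power_iff)

lemma rs_step_odd: "rs_step (2 * n + 1) = - rs_step n"
  unfolding rs_step_def rudin_shapiro_odd by (simp add: minus_one_power_iff)

text \<open>The terms at \<open>2 * i\<close> and \<open>2 * i + 1\<close> are
  \<open>rudin_shapiro i\<close> and \<open>rs_step i\<close>. Pairing them gives their sum here and
  their difference in the alternating case.\<close>

lemma rs_sum_odd: "rs_sum (2 * n + 1) = rs_sum n + rs_alt_sum n"
proof (induction n)
  case 0
  show ?case
    using rudin_shapiro_odd [of 0] by (simp add: rs_sum_Suc rudin_shapiro_0)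
next
  case (Suc n)
  have "rs_sum (2 * Suc n + 1) =
      rs_sum (2 * n + 1) + rudin_shapiro (2 * Suc n) + rudin_shapiro (2 * Suc n + 1)"
    by (simp add: rs_sum_Suc)
  then show ?case
    unfolding Suc rudin_shapiro_even rudin_shapiro_odd
    by (simp add: rs_sum_Suc rs_alt_sum_Suc rs_step_def)
qed

lemma rs_alt_sum_odd: "rs_alt_sum (2 * n + 1) = rs_sum n - rs_alt_sum n"
proof (induction n)
  case 0
  show ?case
    using rs_step_odd [of 0] by (simp add: rs_alt_sum_Suc)
next
  case (Suc n)
  have "rs_alt_sum (2 * Suc n + 1) =
      rs_alt_sum (2 * n + 1) + rs_step (2 * Suc n) + rs_step (2 * Suc n + 1)"
    by (simp add: rs_alt_sum_Suc)
  then show ?case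
    unfolding Suc rs_step_even rs_step_odd
    by (simp add: rs_sum_Suc rs_alt_sum_Suc rs_step_def minus_one_power_iff)
qed

lemma rs_sum_even: "rs_sum (2 * n) = rs_sum n + rs_alt_sum n - rs_step n"
  using rs_sum_odd [of n] rs_sum_Suc [of "2 * n"] rudin_shapiro_odd [of n]
  by (simp add: rs_step_def)

lemma rs_alt_sum_even: "rs_alt_sum (2 * n) = rs_sum n - rs_alt_sum n + rs_step n"
  using rs_alt_sum_odd [of n] rs_alt_sum_Suc [of "2 * n"] rs_step_odd [of n] by simp

text \<open>All \<open>n + 1\<close> summands are odd. The parity of the index, read off the point,
  fixes the sign \<open>(- 1) ^ n\<close> when the recurrences are inverted.\<close>

lemma even_rs_sum_iff: "even (rs_sum n) \<longleftrightarrow> odd n"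
proof (induction n)
  case (Suc n)
  then show ?case
    using rudin_shapiro_cases [of "Suc n"] by (auto simp: rs_sum_Suc)
qed simp

lemma even_rs_alt_sum_iff: "even (rs_alt_sum n) \<longleftrightarrow> odd n"
proof (induction n)
  case (Suc n)
  then show ?case
    using rs_step_cases [of "Suc n"] by (auto simp: rs_alt_sum_Suc)
qed simp

lemma rs_edge_unique:
  assumes "rs_sum m = rs_sum n" "rs_alt_sum m = rs_alt_sum n" "rs_step m = rs_step n"
  shows "m = n"
  using assms
proof (induction "m + n" arbitrary: m n rule: less_induct)
  case less
  have parity: "even m \<longleftrightarrow> even n"
    using even_rs_sum_iff [of m] even_rs_sum_iff [of n] less.prems by simp
  show ?case
  proof (cases "even m")
    case True
    then obtain j k where jk: "m = 2 * j" "n = 2 * k"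
      using parity by (auto elim!: evenE)
    \<comment> \<open>Adding the two even recurrences cancels the steps and leaves
      \<open>2 * rs_sum j\<close>. Its parity then yields the step, and the step yields
      \<open>rs_alt_sum j\<close>.\<close>
    have sum: "rs_sum j = rs_sum k"
      using less.prems unfolding jk rs_sum_even rs_alt_sum_even by linarith
    then have "even j \<longleftrightarrow> even k"
      using even_rs_sum_iff [of j] even_rs_sum_iff [of k] by simp
    then have step: "rs_step j = rs_step k"
      using less.prems(3) unfolding jk rs_step_even by (auto simp: minus_one_power_iff split: if_splits)
    have alt: "rs_alt_sum j = rs_alt_sum k"
      using less.prems sum step unfolding jk rs_sum_even rs_alt_sum_even by linarith
    show ?thesis
    \<comment> \<open>Halving decreases \<open>m + n\<close> unless both indices are 0.\<close>
    proof (cases "j + k = 0")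
      case False
      then have "j = k"
        using less.hyps [of j k] sum alt step jk by fastforce
      then show ?thesis by (simp add: jk)
    qed (simp add: jk)
  next
    case False
    then obtain j k where jk: "m = 2 * j + 1" "n = 2 * k + 1"
      using parity by (auto elim!: oddE)
    have "rs_sum j = rs_sum k" "rs_alt_sum j = rs_alt_sum k" "rs_step j = rs_step k"
      using less.prems unfolding jk rs_sum_odd rs_alt_sum_odd rs_step_odd by linarith+
    then have "j = k"
      using less.hyps [of j k] jk by simp
    then show ?thesis by (simp add: jk)
  qed
qed

text \<open>The last clause rules out, for \<open>b = 1\<close>, an edge from below the axis. For
  \<open>b = - 1\<close> it rules out an edge from above the diagonal if \<open>x\<close> is even,
  and one back down the diagonal if \<open>x\<close> is odd.\<close>

definition admissible_edge :: "int \<Rightarrow> int \<Rightarrow> int \<Rightarrow> bool" where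
  "admissible_edge x y b \<longleftrightarrow> 0 < x \<and> 0 \<le> y \<and> y \<le> x \<and> (even x \<longleftrightarrow> even y) \<and>
     (b = 1 \<and> 0 < y \<or> b = - 1 \<and> y < x)"

text \<open>Passing from \<open>m\<close> to \<open>2 * m + 1\<close> swaps the clauses for upward
  and downward steps. At \<open>2 * m\<close> both coordinates are odd, so only a downward step into
  the diagonal needs an argument.\<close>

lemma admissible_edge_rs: "admissible_edge (rs_sum n) (rs_alt_sum n) (rs_step n)"
proof (induction n rule: less_induct)
  case (less n)
  consider "n = 0" | m where "n = 2 * m" "m < n" | m where "n = 2 * m + 1" "m < n"
    by (cases "n = 0"; cases "even n") (auto elim!: evenE oddE)
  then show ?case
  proof cases
    case 1
    then show ?thesis by (simp add: admissible_edge_def)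
  next
    case 2
    note IH = less [OF 2(2), unfolded admissible_edge_def]
    have odd: "odd (rs_sum n)" "odd (rs_alt_sum n)"
      using 2 by (simp_all add: even_rs_sum_iff even_rs_alt_sum_iff)
    have eqs: "rs_sum n = rs_sum m + rs_alt_sum m - rs_step m"
        "rs_alt_sum n = rs_sum m - rs_alt_sum m + rs_step m"
        "rs_step n = (- 1) ^ m * rs_step m"
      using 2 by (simp_all add: rs_sum_even rs_alt_sum_even rs_step_even)
    have bounds: "0 < rs_sum n" "0 \<le> rs_alt_sum n" "rs_alt_sum n \<le> rs_sum n"
      using IH unfolding eqs by auto
    have "0 < rs_alt_sum n"
      using bounds(2) odd(2) by (cases "rs_alt_sum n = 0") auto
    \<comment> \<open>The difference of the coordinates is
      \<open>2 * (rs_alt_sum m - rs_step m)\<close>, which could vanish only if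
      \<open>rs_alt_sum m\<close> and \<open>rs_step m\<close> were both 1.\<close>
    moreover have "rs_alt_sum n < rs_sum n" if "rs_step n = - 1"
    proof (cases "rs_step m = 1")
      case True
      then have "odd m"
        using that eqs(3) by (auto simp: minus_one_power_iff split: if_splits)
      then have "even (rs_alt_sum m)"
        by (simp add: even_rs_alt_sum_iff)
      then have "rs_alt_sum m \<noteq> 1" by auto
      then show ?thesis
        using IH True unfolding eqs by auto
    next
      case False
      then show ?thesis
        using IH unfolding eqs by auto
    qed
    ultimately show ?thesis
      using bounds odd rs_step_cases [of n] by (auto simp: admissible_edge_def)
  next
    case 3
    then show ?thesis
      using less [OF 3(2)]
      unfolding 3(1) rs_sum_odd rs_alt_sum_odd rs_step_odd admissible_edge_def by auto
  qed
qed

text \<open>The measure \<open>2 x + y\<close> also decreases along \<open>(2k, 2k), (2k, 0), (k, k)\<close>,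
  where neither \<open>x\<close> nor \<open>x + y\<close> decreases at every step.\<close>

lemma admissible_edge_realised:
  assumes "admissible_edge x y b"
  shows "\<exists>n. rs_sum n = x \<and> rs_alt_sum n = y \<and> rs_step n = b"
  using assms
proof (induction "nat (2 * x + y)" arbitrary: x y b rule: less_induct)
  case less
  note adm = less.prems [unfolded admissible_edge_def]
  show ?case
  proof (cases "even x")
    case True
    then obtain k l where kl: "x = 2 * k" "y = 2 * l"
      using adm by (auto elim!: evenE)
    have "admissible_edge (k + l) (k - l) (- b)"
      using adm unfolding admissible_edge_def kl by auto
    moreover have "nat (2 * (k + l) + (k - l)) < nat (2 * x + y)"
      using adm kl by auto
    ultimately obtain n where
      "rs_sum n = k + l" "rs_alt_sum n = k - l" "rs_step n = - b"
      using less.hyps by blast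
    then show ?thesis
      by (intro exI [of _ "2 * n + 1"]) (simp only: rs_sum_odd rs_alt_sum_odd rs_step_odd kl, simp)
  next
    case False
    then obtain k l where kl: "x = 2 * k + 1" "y = 2 * l + 1"
      using adm by (auto elim!: oddE)
    \<comment> \<open>Solving the even recurrences gives \<open>u\<close> as the sum at half the
      index and \<open>v\<close> as the alternating sum minus the step \<open>c\<close>. The half
      index is even iff \<open>u\<close> is odd, which determines the sign in
      \<open>c\<close>.\<close>
    define u v where "u = k + l + 1" and "v = k - l"
    define c where "c = (if odd u then b else - b)"
    show ?thesis
    \<comment> \<open>The edge at index 0 is its own preimage, so the descent stops here.\<close>
    proof (cases "x = 1 \<and> y = 1")
      case True
      then have "b = 1" using adm by auto
      then show ?thesis
        using True by (intro exI [of _ 0]) simp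
    next
      case False
      have c: "c = 1 \<or> c = - 1"
        using adm by (auto simp: c_def)
      have kl_bounds: "0 \<le> l" "l \<le> k" "0 < k"
        using adm False kl by auto
      \<comment> \<open>Only \<open>v = 0\<close> with \<open>c = - 1\<close> could fail. But
        \<open>v = 0\<close> means \<open>x = y\<close>, which forces an upward step and an odd
        \<open>u\<close>.\<close>
      have "0 \<le> v + c"
      proof (cases "v = 0")
        case True
        then have "b = 1" "odd u"
          using adm kl by (auto simp: u_def v_def)
        then show ?thesis using True by (simp add: c_def)
      next
        case False
        then show ?thesis using kl_bounds c by (auto simp: v_def)
      qed
      moreover have "even u \<longleftrightarrow> even (v + c)"
        using c by (auto simp: u_def v_def)
      ultimately have "admissible_edge u (v + c) c"
        using c kl_bounds unfolding admissible_edge_def u_def v_def by auto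
      moreover have "nat (2 * u + (v + c)) < nat (2 * x + y)"
        using kl_bounds c unfolding u_def v_def kl by auto
      ultimately obtain n where
        n: "rs_sum n = u" "rs_alt_sum n = v + c" "rs_step n = c"
        using less.hyps by blast
      have "(- 1) ^ n * c = b"
        using even_rs_sum_iff [of n] n(1) by (auto simp: c_def minus_one_power_iff)
      then show ?thesis
        using n kl by (intro exI [of _ "2 * n"])
          (simp add: rs_sum_even rs_alt_sum_even rs_step_even u_def v_def)
    qed
  qed
qed

lemma rs_visited_iff:
  "(\<exists>n. rs_sum n = x \<and> rs_alt_sum n = y) \<longleftrightarrow>
     0 < x \<and> 0 \<le> y \<and> y \<le> x \<and> (even x \<longleftrightarrow> even y)"
proof
  assume "\<exists>n. rs_sum n = x \<and> rs_alt_sum n = y"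
  then obtain n where "admissible_edge x y (rs_step n)"
    using admissible_edge_rs by metis
  then show "0 < x \<and> 0 \<le> y \<and> y \<le> x \<and> (even x \<longleftrightarrow> even y)"
    by (simp add: admissible_edge_def)
next
  assume "0 < x \<and> 0 \<le> y \<and> y \<le> x \<and> (even x \<longleftrightarrow> even y)"
  \<comment> \<open>On the axis an upward step is excluded, but there \<open>y < x\<close> allows a
    downward one.\<close>
  then have "admissible_edge x y (if 0 < y then 1 else - 1)"
    by (auto simp: admissible_edge_def)
  then show "\<exists>n. rs_sum n = x \<and> rs_alt_sum n = y"
    using admissible_edge_realised by blast
qed

lemma rs_visits:
  "finite {n. (rs_sum n, rs_alt_sum n) = p} \<and> card {n. (rs_sum n, rs_alt_sum n) = p} \<le> 2"
  (is "finite ?V \<and> _")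
proof -
  have inj: "inj_on rs_step ?V"
    by (auto simp: inj_on_def intro: rs_edge_unique)
  have sub: "rs_step ` ?V \<subseteq> {1, - 1}"
    using rs_step_cases by auto
  have "finite ?V"
    using inj_on_finite [OF inj sub] by simp
  moreover have "card ?V \<le> card {1, - 1 :: int}"
    using card_inj_on_le [OF inj sub] by simp
  ultimately show ?thesis by simp
qed

theorem theorem31:
  shows "(\<forall>x y :: nat.
            (\<exists>n. (int x, int y) = (rs_sum n, rs_alt_sum n)) \<longleftrightarrow>
            x \<ge> y \<and> (x, y) \<noteq> (0, 0) \<and> x mod 2 = y mod 2) \<and>
         (\<forall>x y :: nat.
            x \<ge> y \<and> (x, y) \<noteq> (0, 0) \<and> x mod 2 = y mod 2 \<longrightarrow>
            finite {n. (rs_sum n, rs_alt_sum n) = (int x, int y)} \<and>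
            card {n. (rs_sum n, rs_alt_sum n) = (int x, int y)} \<le> 2)"
proof (intro conjI allI impI)
  fix x y :: nat
  have "(\<exists>n. (int x, int y) = (rs_sum n, rs_alt_sum n)) \<longleftrightarrow>
      (\<exists>n. rs_sum n = int x \<and> rs_alt_sum n = int y)"
    by (simp add: eq_commute [of "int _"])
  also have "\<dots> \<longleftrightarrow> 0 < x \<and> y \<le> x \<and> (even x \<longleftrightarrow> even y)"
    by (simp add: rs_visited_iff)
  also have "\<dots> \<longleftrightarrow> x \<ge> y \<and> (x, y) \<noteq> (0, 0) \<and> x mod 2 = y mod 2"
    by (auto simp: mod2_eq_if)
  finally show "(\<exists>n. (int x, int y) = (rs_sum n, rs_alt_sum n)) \<longleftrightarrow>
      x \<ge> y \<and> (x, y) \<noteq> (0, 0) \<and> x mod 2 = y mod 2" .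
qed (use rs_visits in blast)+

end
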